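(* Let $d\in\{2,3,4,6\}$, let $\beta\in\mathbb{C}$, and put $\beta_0=0$ and $\beta_1=\cdots=\beta_{d-1}=\beta$. Let $\mathcal{E}_k=\{k+dj: j\in\mathbb{N}_0\}$ for $0\le k\le d-1$. If $f\in F^2$ satisfies $$(U_{\beta_k}f)^{(j)}(0)=0\quad\text{for each } j\in\mathcal{E}_k\text{ and each }k=0,\dots,d-1,$$ then $f=0$.
   Context: $\mathbb{N}_0=\{0,1,2,\dots\}$. The Fock space $F^2$ is the Hilbert space of all entire functions $f$ on $\mathbb{C}$ with $\|f\|^2=\int_{\mathbb{C}}|f(z)|^2e^{-|z|^2}\,\mathrm{d}A(z)<\infty$, where $\mathrm{d}A(z)=\pi^{-1}\mathrm{d}x\,\mathrm{d}y$, $z=x+iy$. For $\alpha\in\mathbb{C}$, the Weyl operator $U_\alpha:F^2\to F^2$ is the unitary operator defined by $U_\alpha f(z)=e^{-\frac12|\alpha|^2-\overline{\alpha}z}f(z+\alpha)$ (so $U_0$ is the identity). $f^{(j)}$ denotes the $j$-th complex derivative, with $f^{(0)}=f$. *)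

theory Defs
  imports "HOL-Complex_Analysis.Complex_Analysis"
begin

definition area_measure :: "complex measure" where
  "area_measure = density lborel (\<lambda>_. ennreal (1 / pi))"

definition fock_space :: "(complex \<Rightarrow> complex) set" where
  "fock_space = {f. f holomorphic_on UNIV \<and>
     (\<integral>\<^sup>+ z. ennreal ((cmod (f z))\<^sup>2 * exp (- (cmod z)\<^sup>2)) \<partial>area_measure) < \<infinity>}"

definition weyl :: "complex \<Rightarrow> (complex \<Rightarrow> complex) \<Rightarrow> complex \<Rightarrow> complex" where
  "weyl \<alpha> f = (\<lambda>z. exp (- complex_of_real ((cmod \<alpha>)\<^sup>2) / 2 - cnj \<alpha> * z) * f (z + \<alpha>))"

definition progression :: "nat \<Rightarrow> nat \<Rightarrow> nat set" where
  "progression d k = {k + d * j | j. True}"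

end

theory Submission
  imports Defs
begin

text \<open>
  The vanishing conditions say that \<open>g = U\<^sub>\<beta> f\<close> is invariant under rotation by
  \<open>\<omega> = exp (2 \<pi> i / d)\<close> and that the values of \<open>f\<close> on every orbit of this rotation sum to zero.
  Together they give, for \<open>h z = g z * exp (- |z|\<^sup>2 / 2)\<close>, a linear relation between the twisted translates of
  \<open>h\<close> by the points \<open>\<omega>\<^sup>-\<^sup>m \<beta>\<close>. Since \<open>d \<in> {2, 3, 4, 6}\<close>, these points lie in a lattice, so \<open>h\<close>
  restricted to almost every coset of that lattice is a square summable solution of a magnetic difference equation
  on \<open>\<int>\<^sup>2\<close>. Such a solution vanishes, by the argument of Delyon and Souillard: the solutions of the equation,
  restricted to a box of \<open>N\<^sup>2\<close> points, form a space of dimension \<open>O(N)\<close>, which is too small to contain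
  the magnetic translates of a nonzero square summable solution by all points of the box.
\<close>

section \<open>The rank argument\<close>

definition ip :: "'a set \<Rightarrow> ('a \<Rightarrow> complex) \<Rightarrow> ('a \<Rightarrow> complex) \<Rightarrow> complex" where
  "ip S u v = (\<Sum>x\<in>S. u x * cnj (v x))"

definition sqn :: "'a set \<Rightarrow> ('a \<Rightarrow> complex) \<Rightarrow> real" where
  "sqn S u = (\<Sum>x\<in>S. (cmod (u x))\<^sup>2)"

lemma sqn_nonneg [simp]: "0 \<le> sqn S u"
  by (simp add: sqn_def sum_nonneg)

lemma sqn_eq_ip: "complex_of_real (sqn S u) = ip S u u"
  unfolding sqn_def ip_def of_real_sum
  by (intro sum.cong refl) (metis complex_norm_square of_real_power)

lemma cnj_ip: "cnj (ip S u v) = ip S v u"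
  by (simp add: ip_def mult.commute)

lemma ip_add_left: "ip S (\<lambda>x. u x + c * w x) v = ip S u v + c * ip S w v"
  by (simp add: ip_def algebra_simps sum.distrib sum_distrib_left)

lemma ip_add_right: "ip S v (\<lambda>x. u x + c * w x) = ip S v u + cnj c * ip S v w"
  by (simp add: ip_def algebra_simps sum.distrib sum_distrib_left)

lemma sqn_eq_0_iff: "finite S \<Longrightarrow> sqn S u = 0 \<longleftrightarrow> (\<forall>x\<in>S. u x = 0)"
  by (simp add: sqn_def sum_nonneg_eq_0_iff)

text \<open>Pythagoras along the unit vector \<open>e\<close>. The remainder has the shape
  \<open>u + c * e\<close>, so that the linearity rules for \<open>ip\<close> and the closure
  property of solution spaces apply to it literally.\<close>

lemma sqn_project:
  assumes "ip S e e = 1"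
  shows "sqn S u = (cmod (ip S u e))\<^sup>2 + sqn S (\<lambda>x. u x + (- ip S u e) * e x)"
proof -
  have "complex_of_real (sqn S (\<lambda>x. u x + (- ip S u e) * e x))
      = complex_of_real (sqn S u) - ip S u e * ip S e u"
    unfolding sqn_eq_ip ip_add_left ip_add_right using assms
    by (simp add: cnj_ip algebra_simps)
  also have "ip S u e * ip S e u = complex_of_real ((cmod (ip S u e))\<^sup>2)"
    by (metis cnj_ip complex_norm_square of_real_power)
  finally show ?thesis
    by (metis add.commute diff_add_cancel of_real_diff of_real_eq_iff)
qed

text \<open>
  The functionals \<open>\<phi>\<close> bound the dimension of \<open>V\<close> on \<open>S\<close> by \<open>r\<close>. The induction splits off one unit vector
  \<open>e \<in> V\<close> at a time; each contributes at most \<open>C\<close> by the Bessel-type bound on \<open>h'\<close>, and projecting onto the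
  complement of \<open>e\<close> does not increase the distance between \<open>h'\<close> and \<open>h\<close>.
\<close>

lemma sum_sqn_le_rank:
  fixes V :: "('a \<Rightarrow> complex) set" and h h' :: "'b \<Rightarrow> 'a \<Rightarrow> complex"
    and r :: nat and C :: real and \<phi> :: "nat \<Rightarrow> ('a \<Rightarrow> complex) \<Rightarrow> complex"
  assumes "finite S" and "0 \<le> C"
    and "\<And>u v c. u \<in> V \<Longrightarrow> v \<in> V \<Longrightarrow> (\<lambda>x. u x + c * v x) \<in> V"
    and "\<And>i u v c. i < r \<Longrightarrow> u \<in> V \<Longrightarrow> v \<in> V \<Longrightarrow> \<phi> i (\<lambda>x. u x + c * v x) = \<phi> i u + c * \<phi> i v"
    and "\<And>v x. v \<in> V \<Longrightarrow> (\<And>i. i < r \<Longrightarrow> \<phi> i v = 0) \<Longrightarrow> x \<in> S \<Longrightarrow> v x = 0"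
    and "\<And>\<mu>. \<mu> \<in> M \<Longrightarrow> h \<mu> \<in> V"
    and "\<And>e. (\<Sum>\<mu>\<in>M. (cmod (ip S (h' \<mu>) e))\<^sup>2) \<le> C * sqn S e"
  shows "(\<Sum>\<mu>\<in>M. sqn S (h' \<mu>)) \<le> r * C + (\<Sum>\<mu>\<in>M. sqn S (\<lambda>x. h' \<mu> x - h \<mu> x))"
  using assms
proof (induction r arbitrary: V \<phi> h h')
  case 0
  \<comment> \<open>With no functionals every element of \<open>V\<close> vanishes on
    \<open>S\<close>, so subtracting \<open>h\<close> changes nothing there.\<close>
  have "sqn S (h' \<mu>) = sqn S (\<lambda>x. h' \<mu> x - h \<mu> x)" if "\<mu> \<in> M" for \<mu>
    unfolding sqn_def using 0(5)[OF 0(6)[OF that]] by (intro sum.cong refl) simp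
  then show ?case by simp
next
  case (Suc r)
  note V = Suc.prems(3) and lin = Suc.prems(4) and det = Suc.prems(5) and hV = Suc.prems(6)
    and bd = Suc.prems(7)
  show ?case
  proof (cases "\<forall>v\<in>V. \<forall>x\<in>S. v x = 0")
    case True
    have "sqn S (h' \<mu>) = sqn S (\<lambda>x. h' \<mu> x - h \<mu> x)" if "\<mu> \<in> M" for \<mu>
      unfolding sqn_def by (intro sum.cong refl) (simp add: bspec[OF bspec[OF True hV[OF that]]])
    then show ?thesis using \<open>0 \<le> C\<close> by simp
  next
    case False
    then obtain v where v: "v \<in> V" "sqn S v \<noteq> 0"
      using sqn_eq_0_iff[OF \<open>finite S\<close>] by blast
    have zV: "(\<lambda>x. 0) \<in> V" using V[of v v "-1"] v by simp
    define s where "s = complex_of_real (1 / sqrt (sqn S v))"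
    define e where "e = (\<lambda>x. 0 + s * v x)"
    have eV: "e \<in> V" unfolding e_def by (rule V[OF zV v(1)])
    have "ip S e e = s * cnj s * ip S v v"
      by (simp add: e_def ip_def sum_distrib_left algebra_simps)
    also have "\<dots> = complex_of_real (1 / sqrt (sqn S v) * (1 / sqrt (sqn S v)) * sqn S v)"
      unfolding s_def sqn_eq_ip[symmetric] complex_cnj_complex_of_real of_real_mult[symmetric] ..
    also have "\<dots> = 1"
    proof -
      define t where "t = sqrt (sqn S v)"
      have "t \<noteq> 0" "sqn S v = t * t" using v(2) by (simp_all add: t_def)
      then show ?thesis unfolding t_def[symmetric] by (simp del: of_real_mult)
    qed
    finally have ee: "ip S e e = 1" .
    have "\<exists>i<Suc r. \<phi> i e \<noteq> 0"
    proof (rule ccontr)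
      assume "\<not> ?thesis"
      then have "\<forall>x\<in>S. e x = 0" using det[OF eV] by blast
      with ee show False by (simp add: ip_def)
    qed
    then obtain j where j: "j < Suc r" "\<phi> j e \<noteq> 0" by blast
    \<comment> \<open>\<open>\<sigma>\<close> enumerates the indices other than \<open>j\<close>,
      and \<open>\<psi> i\<close> is \<open>\<phi> (\<sigma> i)\<close> corrected by a multiple of
      \<open>\<phi> j\<close> so that it kills \<open>e\<close>. Thus \<open>r\<close> functionals
      remain for the orthogonal complement \<open>V'\<close> of \<open>e\<close> in
      \<open>V\<close>.\<close>
    define \<sigma> where "\<sigma> i = (if i < j then i else Suc i)" for i
    have \<sigma>: "\<sigma> i < Suc r" if "i < r" for i using that j by (auto simp: \<sigma>_def)
    have \<sigma>': "\<exists>i<r. k = \<sigma> i" if "k < Suc r" "k \<noteq> j" for k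
    proof (cases "k < j")
      case True then show ?thesis using j by (intro exI[of _ k]) (auto simp: \<sigma>_def)
    next
      case False then show ?thesis using that by (intro exI[of _ "k - 1"]) (auto simp: \<sigma>_def)
    qed
    define \<psi> where "\<psi> i v = \<phi> (\<sigma> i) v - \<phi> (\<sigma> i) e / \<phi> j e * \<phi> j v" for i v
    define V' where "V' = {v \<in> V. ip S v e = 0}"
    define P where "P u = (\<lambda>x. u x + (- ip S u e) * e x)" for u
    have PV: "P u \<in> V'" if "u \<in> V" for u
      unfolding V'_def P_def mem_Collect_eq
      by (intro conjI V[OF that eV]) (simp add: ip_add_left[of S u "- ip S u e" e e, simplified] ee)
    \<comment> \<open>The projection is self-adjoint, which moves it from \<open>h'\<close> to the
      test vector in the Bessel-type bound.\<close>
    have ipP: "ip S (P u) w = ip S u (P w)" for u w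
      unfolding P_def ip_add_left ip_add_right using cnj_ip[of S w e] by simp
    have sqP: "sqn S u = (cmod (ip S u e))\<^sup>2 + sqn S (P u)" for u
      unfolding P_def by (rule sqn_project[OF ee])
    have IH: "(\<Sum>\<mu>\<in>M. sqn S (P (h' \<mu>))) \<le> r * C + (\<Sum>\<mu>\<in>M. sqn S (\<lambda>x. P (h' \<mu>) x - P (h \<mu>) x))"
    proof (rule Suc.IH[where V = V' and \<phi> = \<psi>])
      show "(\<lambda>x. u x + c * w x) \<in> V'" if "u \<in> V'" "w \<in> V'" for u w c
        using that V by (auto simp: V'_def ip_add_left)
      show "\<psi> i (\<lambda>x. u x + c * w x) = \<psi> i u + c * \<psi> i w" if "i < r" "u \<in> V'" "w \<in> V'" for i u w c
        using that lin[OF \<sigma>] lin[OF j(1)] unfolding V'_def \<psi>_def by (simp add: algebra_simps)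
      show "w x = 0" if w: "w \<in> V'" and z: "\<And>i. i < r \<Longrightarrow> \<psi> i w = 0" and "x \<in> S" for w x
      proof -
        \<comment> \<open>This \<open>c\<close> makes \<open>\<phi> j\<close> vanish on
          \<open>w - c * e\<close>, and the conditions on \<open>\<psi>\<close> then do the same for
          the other indices. Hence \<open>w = c * e\<close> on \<open>S\<close>, and orthogonality
          to \<open>e\<close> forces \<open>c = 0\<close>.\<close>
        define c where "c = \<phi> j w / \<phi> j e"
        have wV: "w \<in> V" and we: "ip S w e = 0" using w by (auto simp: V'_def)
        have "\<phi> k (\<lambda>x. w x + (- c) * e x) = 0" if k: "k < Suc r" for k
        proof (cases "k = j")
          case True
          then show ?thesis using lin[OF k wV eV, of "- c"] j by (simp add: c_def)
        next
          case False
          then obtain i where "i < r" "k = \<sigma> i" using \<sigma>' k by blast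
          then show ?thesis using z[of i] lin[OF k wV eV, of "- c"] by (simp add: c_def \<psi>_def)
        qed
        then have 0: "w y = c * e y" if "y \<in> S" for y
          using det[OF V[OF wV eV, of "- c"] _ that] by simp
        then have "ip S w e = c * ip S e e"
          by (simp add: ip_def sum_distrib_left mult.assoc)
        then have "c = 0" using we ee by simp
        then show ?thesis using 0 \<open>x \<in> S\<close> by simp
      qed
      show "P (h \<mu>) \<in> V'" if "\<mu> \<in> M" for \<mu> using PV hV that by blast
      show "(\<Sum>\<mu>\<in>M. (cmod (ip S (P (h' \<mu>)) w))\<^sup>2) \<le> C * sqn S w" for w
      proof -
        have "sqn S (P w) \<le> sqn S w" using sqP[of w] by simp
        then show ?thesis unfolding ipP using bd[of "P w"] \<open>0 \<le> C\<close>
          by (meson mult_left_mono order_trans)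
      qed
    qed (use \<open>finite S\<close> \<open>0 \<le> C\<close> in auto)
    have le: "sqn S (\<lambda>x. P (h' \<mu>) x - P (h \<mu>) x) \<le> sqn S (\<lambda>x. h' \<mu> x - h \<mu> x)" for \<mu>
    proof -
      have "(\<lambda>x. P (h' \<mu>) x - P (h \<mu>) x) = P (\<lambda>x. h' \<mu> x - h \<mu> x)"
        using ip_add_left[of S "h' \<mu>" "-1" "h \<mu>" e] by (simp add: P_def fun_eq_iff left_diff_distrib)
      then show ?thesis using sqP[of "\<lambda>x. h' \<mu> x - h \<mu> x"] by simp
    qed
    have "(\<Sum>\<mu>\<in>M. sqn S (h' \<mu>)) = (\<Sum>\<mu>\<in>M. (cmod (ip S (h' \<mu>) e))\<^sup>2) + (\<Sum>\<mu>\<in>M. sqn S (P (h' \<mu>)))"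
      by (subst sqP) (simp add: sum.distrib)
    also have "\<dots> \<le> C + (r * C + (\<Sum>\<mu>\<in>M. sqn S (\<lambda>x. h' \<mu> x - h \<mu> x)))"
    proof (rule add_mono)
      have "sqn S e = 1" using ee sqn_eq_ip[of S e] by (metis of_real_eq_1_iff)
      then show "(\<Sum>\<mu>\<in>M. (cmod (ip S (h' \<mu>) e))\<^sup>2) \<le> C" using bd[of e] by simp
      show "(\<Sum>\<mu>\<in>M. sqn S (P (h' \<mu>))) \<le> r * C + (\<Sum>\<mu>\<in>M. sqn S (\<lambda>x. h' \<mu> x - h \<mu> x))"
        by (rule order_trans[OF IH]) (intro add_left_mono sum_mono le)
    qed
    finally show ?thesis by (simp add: algebra_simps)
  qed
qed

text \<open>Schur test: all row and column sums of the matrix \<open>cmod (k (x - \<mu>))\<close>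
  are at most the l1 norm of \<open>k\<close>, and the unimodular twist \<open>a\<close> disappears
  in absolute values. The constant does not depend on \<open>S\<close>, which the rank argument
  exploits for large boxes.\<close>

lemma schur_bound:
  fixes k :: "'g::ab_group_add \<Rightarrow> complex" and a :: "'g \<Rightarrow> 'g \<Rightarrow> complex"
  assumes fin: "finite S" "finite F" and k0: "\<And>x. x \<notin> F \<Longrightarrow> k x = 0"
    and a: "\<And>\<mu> x. cmod (a \<mu> x) = 1"
  shows "(\<Sum>\<mu>\<in>S. (cmod (ip S (\<lambda>x. a \<mu> x * k (x - \<mu>)) e))\<^sup>2) \<le> (\<Sum>x\<in>F. cmod (k x))\<^sup>2 * sqn S e"
proof -
  define K where "K = (\<Sum>x\<in>F. cmod (k x))"
  have K0: "0 \<le> K" by (simp add: K_def sum_nonneg)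
  have T: "(\<Sum>x\<in>S. cmod (k (t x))) \<le> K" if "inj_on t S" for t
  proof -
    have "(\<Sum>x\<in>S. cmod (k (t x))) = (\<Sum>y\<in>t ` S. cmod (k y))"
      using that by (simp add: sum.reindex)
    also have "\<dots> = (\<Sum>y\<in>t ` S \<inter> F. cmod (k y))"
      using fin k0 by (intro sum.mono_neutral_right) auto
    also have "\<dots> \<le> K" unfolding K_def using fin by (intro sum_mono2) auto
    finally show ?thesis .
  qed
  have "(cmod (ip S (\<lambda>x. a \<mu> x * k (x - \<mu>)) e))\<^sup>2
      \<le> K * (\<Sum>x\<in>S. cmod (k (x - \<mu>)) * (cmod (e x))\<^sup>2)" for \<mu>
  proof -
    have "cmod (ip S (\<lambda>x. a \<mu> x * k (x - \<mu>)) e) \<le> (\<Sum>x\<in>S. cmod (k (x - \<mu>)) * cmod (e x))"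
      unfolding ip_def by (rule order_trans[OF norm_sum]) (simp add: norm_mult a)
    \<comment> \<open>Splitting each weight into two square roots lets Cauchy-Schwarz leave one
      plain sum of weights, bounded by \<open>K\<close>.\<close>
    also have "\<dots> = (\<Sum>x\<in>S. sqrt (cmod (k (x - \<mu>))) * (sqrt (cmod (k (x - \<mu>))) * cmod (e x)))"
      by (simp flip: mult.assoc)
    finally have "(cmod (ip S (\<lambda>x. a \<mu> x * k (x - \<mu>)) e))\<^sup>2 \<le> \<dots>\<^sup>2"
      by (intro power_mono) auto
    also have "\<dots> \<le> (\<Sum>x\<in>S. (sqrt (cmod (k (x - \<mu>))))\<^sup>2) *
        (\<Sum>x\<in>S. (sqrt (cmod (k (x - \<mu>))) * cmod (e x))\<^sup>2)"
      by (rule Cauchy_Schwarz_ineq_sum)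
    also have "\<dots> = (\<Sum>x\<in>S. cmod (k (x - \<mu>))) * (\<Sum>x\<in>S. cmod (k (x - \<mu>)) * (cmod (e x))\<^sup>2)"
      by (simp add: power_mult_distrib)
    also have "\<dots> \<le> K * (\<Sum>x\<in>S. cmod (k (x - \<mu>)) * (cmod (e x))\<^sup>2)"
      by (intro mult_right_mono T sum_nonneg) (auto simp: inj_on_def)
    finally show ?thesis .
  qed
  then have "(\<Sum>\<mu>\<in>S. (cmod (ip S (\<lambda>x. a \<mu> x * k (x - \<mu>)) e))\<^sup>2)
      \<le> (\<Sum>\<mu>\<in>S. K * (\<Sum>x\<in>S. cmod (k (x - \<mu>)) * (cmod (e x))\<^sup>2))"
    by (rule sum_mono)
  also have "\<dots> = K * (\<Sum>x\<in>S. (\<Sum>\<mu>\<in>S. cmod (k (x - \<mu>))) * (cmod (e x))\<^sup>2)"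
    unfolding sum_distrib_left[symmetric] sum_distrib_right by (subst sum.swap) simp
  also have "\<dots> \<le> K * (\<Sum>x\<in>S. K * (cmod (e x))\<^sup>2)"
    by (intro mult_left_mono sum_mono mult_right_mono T K0) (auto simp: inj_on_def)
  also have "\<dots> = K\<^sup>2 * sqn S e"
    by (simp add: sqn_def sum_distrib_left power2_eq_square mult.assoc)
  finally show ?thesis unfolding K_def .
qed

text \<open>The point \<open>x0\<close> is forced into \<open>F\<close> so that cutting a function
  off to \<open>F\<close> keeps its value there.\<close>

lemma finite_tail:
  fixes p :: "'a \<Rightarrow> real"
  assumes "p summable_on UNIV" "\<And>x. 0 \<le> p x" "0 < \<epsilon>"
  obtains F where "finite F" "x0 \<in> F" "\<And>X. finite X \<Longrightarrow> X \<inter> F = {} \<Longrightarrow> sum p X \<le> \<epsilon>"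
proof -
  have "(p has_sum infsum p UNIV) UNIV" using assms(1) by (rule has_sum_infsum)
  then have "eventually (\<lambda>X. dist (sum p X) (infsum p UNIV) < \<epsilon>) (finite_subsets_at_top UNIV)"
    using assms(3) unfolding has_sum_def by (rule tendstoD)
  then obtain F0 where F0: "finite F0"
    "\<And>Y. finite Y \<Longrightarrow> F0 \<subseteq> Y \<Longrightarrow> dist (sum p Y) (infsum p UNIV) < \<epsilon>"
    unfolding eventually_finite_subsets_at_top by (metis subset_UNIV)
  show ?thesis
  proof (rule that[of "insert x0 F0"])
    fix X assume X: "finite X" "X \<inter> insert x0 F0 = {}"
    have "sum p (insert x0 F0) + sum p X = sum p (insert x0 F0 \<union> X)"
      using X F0(1) by (intro sum.union_disjoint[symmetric]) auto
    also have "\<dots> \<le> infsum p UNIV"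
      using X F0(1) assms by (intro finite_sum_le_infsum) auto
    also have "\<dots> < sum p (insert x0 F0) + \<epsilon>"
      using F0(2)[of "insert x0 F0"] F0(1) by (simp add: dist_real_def subset_insertI)
    finally show "sum p X \<le> \<epsilon>" by simp
  qed (use F0 in auto)
qed

text \<open>
  For finite \<open>F\<close> with small tail outside, the translates of \<open>h\<close> cut off to \<open>F\<close> form a matrix on \<open>S \<times> S\<close> of
  operator norm at most \<open>\<Sum>x\<in>F. |h x|\<close> that is close, relative to \<open>card S\<close>, to a matrix of rank at most
  \<open>card D\<close>; its Hilbert-Schmidt norm is of order \<open>card S\<close>.
\<close>

lemma twisted_translates_zero:
  fixes h :: "'g::ab_group_add \<Rightarrow> complex" and a :: "'g \<Rightarrow> 'g \<Rightarrow> complex"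
    and V :: "('g \<Rightarrow> complex) set"
  assumes summ: "(\<lambda>x. (cmod (h x))\<^sup>2) summable_on UNIV"
    and V: "\<And>u v c. u \<in> V \<Longrightarrow> v \<in> V \<Longrightarrow> (\<lambda>x. u x + c * v x) \<in> V"
    and a: "\<And>\<mu> x. cmod (a \<mu> x) = 1"
    and tr: "\<And>\<mu>. (\<lambda>x. a \<mu> x * h (x - \<mu>)) \<in> V"
    and det: "\<And>n::nat. \<exists>S D. finite S \<and> finite D \<and> S \<noteq> {} \<and> n * card D \<le> card S \<and>
                (\<forall>v\<in>V. (\<forall>x\<in>D. v x = 0) \<longrightarrow> (\<forall>x\<in>S. v x = 0))"
  shows "h 0 = 0"
proof (rule ccontr)
  assume "h 0 \<noteq> 0"
  \<comment> \<open>Each \<open>\<mu>\<close> contributes at least \<open>2 * \<epsilon>\<close>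
    through its diagonal entry, while cutting off to \<open>F\<close> costs at most
    \<open>\<epsilon>\<close>; the rank term has to pay for the difference.\<close>
  define \<epsilon> where "\<epsilon> = (cmod (h 0))\<^sup>2 / 2"
  have \<epsilon>: "0 < \<epsilon>" using \<open>h 0 \<noteq> 0\<close> by (simp add: \<epsilon>_def)
  obtain F where F: "finite F" "0 \<in> F"
    "\<And>X. finite X \<Longrightarrow> X \<inter> F = {} \<Longrightarrow> (\<Sum>x\<in>X. (cmod (h x))\<^sup>2) \<le> \<epsilon>"
    by (rule finite_tail[OF summ _ \<epsilon>, of 0]) auto
  define k where "k x = (if x \<in> F then h x else 0)" for x
  define C where "C = (\<Sum>x\<in>F. cmod (k x))\<^sup>2"
  \<comment> \<open>With this \<open>n\<close> the rank term \<open>card D * C\<close> is too small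
    to reach \<open>card S * \<epsilon>\<close>.\<close>
  obtain n :: nat where n: "C / \<epsilon> < n" using reals_Archimedean2 by blast
  obtain S D where S: "finite S" "finite D" "S \<noteq> {}" "n * card D \<le> card S"
    and SD: "\<And>v x. v \<in> V \<Longrightarrow> (\<forall>x\<in>D. v x = 0) \<Longrightarrow> x \<in> S \<Longrightarrow> v x = 0"
    using det[of n] by blast
  obtain g where g: "bij_betw g {..<card D} D"
    using \<open>finite D\<close> by (metis atLeast0LessThan ex_bij_betw_nat_finite)
  define H where "H \<mu> = (\<lambda>x. a \<mu> x * h (x - \<mu>))" for \<mu>
  define H' where "H' \<mu> = (\<lambda>x. a \<mu> x * k (x - \<mu>))" for \<mu>
  have ineq: "(\<Sum>\<mu>\<in>S. sqn S (H' \<mu>)) \<le> card D * C + (\<Sum>\<mu>\<in>S. sqn S (\<lambda>x. H' \<mu> x - H \<mu> x))"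
  proof (rule sum_sqn_le_rank[where V = V and \<phi> = "\<lambda>i v. v (g i)"])
    show "v x = 0" if "v \<in> V" "\<And>i. i < card D \<Longrightarrow> v (g i) = 0" "x \<in> S" for v x
    proof (rule SD[OF that(1) _ that(3)])
      show "\<forall>x\<in>D. v x = 0" using that(2) g unfolding bij_betw_def by (metis imageE lessThan_iff)
    qed
    show "(\<Sum>\<mu>\<in>S. (cmod (ip S (H' \<mu>) e))\<^sup>2) \<le> C * sqn S e" for e
      unfolding H'_def C_def using S F a by (intro schur_bound) (auto simp: k_def)
  qed (use S V tr in \<open>auto simp: C_def H_def\<close>)
  have "card S * (2 * \<epsilon>) = (\<Sum>\<mu>\<in>S. (cmod (h 0))\<^sup>2)" by (simp add: \<epsilon>_def)
  also have "\<dots> \<le> (\<Sum>\<mu>\<in>S. sqn S (H' \<mu>))"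
  proof (rule sum_mono)
    fix \<mu> assume \<mu>: "\<mu> \<in> S"
    have "(cmod (h 0))\<^sup>2 = (cmod (H' \<mu> \<mu>))\<^sup>2"
      using F by (simp add: H'_def k_def norm_mult a)
    also have "\<dots> \<le> sqn S (H' \<mu>)" unfolding sqn_def
      using \<mu> S by (intro member_le_sum) auto
    finally show "(cmod (h 0))\<^sup>2 \<le> sqn S (H' \<mu>)" .
  qed
  also note ineq
  also have "(\<Sum>\<mu>\<in>S. sqn S (\<lambda>x. H' \<mu> x - H \<mu> x)) \<le> (\<Sum>\<mu>\<in>S. \<epsilon>)"
  proof (rule sum_mono)
    fix \<mu> assume \<mu>: "\<mu> \<in> S"
    let ?X = "(\<lambda>x. x - \<mu>) ` S - F"
    have "sqn S (\<lambda>x. H' \<mu> x - H \<mu> x) = (\<Sum>x\<in>S. (cmod (k (x - \<mu>) - h (x - \<mu>)))\<^sup>2)"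
      unfolding sqn_def H'_def H_def right_diff_distrib[symmetric] by (simp add: norm_mult a)
    also have "\<dots> = (\<Sum>y\<in>(\<lambda>x. x - \<mu>) ` S. (cmod (k y - h y))\<^sup>2)"
      by (simp add: sum.reindex inj_on_def)
    also have "\<dots> = (\<Sum>y\<in>?X. (cmod (k y - h y))\<^sup>2)"
      using S by (intro sum.mono_neutral_right) (auto simp: k_def)
    also have "\<dots> = (\<Sum>y\<in>?X. (cmod (h y))\<^sup>2)"
      by (intro sum.cong) (auto simp: k_def)
    also have "\<dots> \<le> \<epsilon>" using S by (intro F(3)) auto
    finally show "sqn S (\<lambda>x. H' \<mu> x - H \<mu> x) \<le> \<epsilon>" .
  qed
  finally have 1: "card S * \<epsilon> \<le> card D * C" by (simp add: mult.commute)
  have 2: "C < n * \<epsilon>" using n \<epsilon> by (simp add: field_simps)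
  have cS: "0 < card S" using S by (simp add: card_gt_0_iff)
  show False
  proof (cases "card D = 0")
    case True
    then show False using 1 cS \<epsilon> by (simp add: mult_le_0_iff)
  next
    case False
    then have "card D * C < card D * (n * \<epsilon>)" using 2 by simp
    also have "\<dots> = real (n * card D) * \<epsilon>" by simp
    also have "\<dots> \<le> card S * \<epsilon>" using S(4) \<epsilon> by (intro mult_right_mono) (auto simp del: of_nat_mult)
    finally show False using 1 by simp
  qed
qed

text \<open>
  Since \<open>os m0\<close> is the only lowest offset, the relation at \<open>x\<close> expresses \<open>v (x - os m0)\<close> by values of \<open>v\<close> in
  the four rows below it, so four initial rows of length \<open>O(N)\<close> determine the box.
\<close>

lemma bands_determine_boxes:
  fixes os :: "nat \<Rightarrow> int \<times> int" and c :: "nat \<Rightarrow> int \<times> int \<Rightarrow> complex" and n :: nat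
  assumes m0: "m0 < d" "\<And>x. c m0 x \<noteq> 0"
    and low: "\<And>m. m < d \<Longrightarrow> m \<noteq> m0 \<Longrightarrow> snd (os m0) < snd (os m)"
    and bd: "\<And>m. m < d \<Longrightarrow> \<bar>fst (os m)\<bar> \<le> 1 \<and> \<bar>snd (os m)\<bar> \<le> 2"
  shows "\<exists>S D. finite S \<and> finite D \<and> S \<noteq> {} \<and> n * card D \<le> card S \<and>
    (\<forall>v\<in>{v. \<forall>x. (\<Sum>m<d. c m x * v (x - os m)) = 0}. (\<forall>x\<in>D. v x = 0) \<longrightarrow> (\<forall>x\<in>S. v x = 0))"
proof -
  \<comment> \<open>The box has about \<open>N^2\<close> points and the four initial rows about
    \<open>20 * N\<close>, so a multiple of \<open>n\<close> makes the ratio at least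
    \<open>n\<close>; for \<open>n = 0\<close> the box is still nonempty.\<close>
  define N :: int where "N = 100 * int n"
  define S where "S = {0..N} \<times> {0..N}"
  define D where "D = {- 2 * N - 6..3 * N + 6} \<times> {-3..0::int}"
  have "v x = 0" if v: "\<And>x. (\<Sum>m<d. c m x * v (x - os m)) = 0" and D: "\<forall>x\<in>D. v x = 0"
    and x: "x \<in> S" for v x
  proof -
    \<comment> \<open>Two first coordinates of offsets differ by at most 2, so the determined region
      is a trapezoid that widens by 2 on each side per row downwards. Second coordinates differ by
      at most 4, so a row \<open>q > 0\<close> uses only rows from \<open>q - 4 >= -3\<close> on. At
      \<open>q = -3\<close> the width is that of \<open>D\<close>.\<close>
    have main: "v (p, q) = 0"
      if "q \<le> N" "- 3 \<le> q" "- 2 * (N - q) \<le> p" "p \<le> N + 2 * (N - q)" for p q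
      using that
    proof (induction "nat (q + 3)" arbitrary: p q rule: less_induct)
      case less
      show ?case
      proof (cases "q \<le> 0")
        case True
        then show ?thesis using less.prems D by (auto simp: D_def)
      next
        case False
        let ?z = "(p, q) + os m0"
        have "v (?z - os m) = 0" if m: "m < d" "m \<noteq> m0" for m
        proof -
          have *: "?z - os m = (p + fst (os m0) - fst (os m), q + snd (os m0) - snd (os m))"
            by (auto simp: prod_eq_iff)
          show ?thesis unfolding *
            by (rule less.hyps) (use bd[OF m(1)] bd[OF m0(1)] low[OF m] False less.prems in auto)
        qed
        then have "(\<Sum>m<d. c m ?z * v (?z - os m)) = c m0 ?z * v (?z - os m0)"
          using m0(1) by (subst sum.remove[of _ m0]) (auto intro!: sum.neutral)
        then show ?thesis using v[of ?z] m0(2)[of ?z] by simp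
      qed
    qed
    show ?thesis using x main[of "snd x" "fst x"] by (auto simp: S_def)
  qed
  moreover have "n * card D \<le> card S"
  proof -
    have D: "card D = (500 * n + 13) * 4"
      by (simp add: D_def N_def card_cartesian_product)
    have S: "card S = (100 * n + 1) * (100 * n + 1)"
      by (simp add: S_def N_def card_cartesian_product nat_add_distrib nat_mult_distrib)
    show ?thesis unfolding D S
      by (cases n) (simp_all add: algebra_simps)
  qed
  ultimately show ?thesis
    by (intro exI[of _ S] exI[of _ D]) (auto simp: S_def D_def N_def)
qed

section \<open>Twisted relations on the plane\<close>

text \<open>By Tonelli and translation invariance, the integral over the ball of the sum of all
  translates of \<open>G\<close> is the integral of \<open>G\<close> over the balls around
  \<open>x0 + \<phi> i\<close>. These are disjoint by \<open>sep\<close>, so it is finite and the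
  sum converges somewhere in the ball.\<close>

lemma exists_summable_translate:
  fixes G :: "complex \<Rightarrow> real" and \<phi> :: "'i::countable \<Rightarrow> complex"
  assumes G: "G \<in> borel_measurable borel" "\<And>z. 0 \<le> G z"
    and fin: "(\<integral>\<^sup>+ z. ennreal (G z) \<partial>lborel) < \<infinity>"
    and sep: "\<And>i j. i \<noteq> j \<Longrightarrow> 2 * r \<le> dist (\<phi> i) (\<phi> j)" and "0 < r"
  obtains x where "x \<in> ball x0 r" "(\<lambda>i. G (x + \<phi> i)) summable_on UNIV"
proof -
  let ?I = "\<lambda>i x. ennreal (G (x + \<phi> i)) * indicator (ball x0 r) x"
  let ?J = "\<lambda>i y. ennreal (G y) * indicator (ball (x0 + \<phi> i) r) y"
  have "(\<lambda>x. G (x + \<phi> i)) \<in> borel_measurable borel" for i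
    using G(1) by (rule measurable_compose[rotated]) simp
  then have mI: "?I i \<in> borel_measurable borel" for i
    by (intro borel_measurable_times_ennreal borel_measurable_indicator measurable_compose[OF _ measurable_ennreal]) auto
  have mJ: "?J i \<in> borel_measurable borel" for i
    by (intro borel_measurable_times_ennreal borel_measurable_indicator measurable_compose[OF _ measurable_ennreal] G(1)) auto
  have shift: "(\<integral>\<^sup>+ x. ?I i x \<partial>lborel) = (\<integral>\<^sup>+ y. ?J i y \<partial>lborel)" for i
  proof -
    have "(\<integral>\<^sup>+ y. ?J i y \<partial>lborel) = (\<integral>\<^sup>+ y. ?J i y \<partial>distr lborel borel ((+) (\<phi> i)))"
      by (simp only: lborel_distr_plus)
    also have "\<dots> = (\<integral>\<^sup>+ x. ?J i (\<phi> i + x) \<partial>lborel)"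
      by (rule nn_integral_distr) (use mJ in auto)
    also have "\<dots> = (\<integral>\<^sup>+ x. ?I i x \<partial>lborel)"
      by (intro nn_integral_cong) (auto simp: indicator_def dist_norm algebra_simps)
    finally show ?thesis by simp
  qed
  have "(\<integral>\<^sup>+ x. (\<integral>\<^sup>+ i. ?I i x \<partial>count_space UNIV) \<partial>lborel)
      = (\<integral>\<^sup>+ i. (\<integral>\<^sup>+ x. ?I i x \<partial>lborel) \<partial>count_space UNIV)"
    by (rule nn_integral_count_space_nn_integral) (use mI in auto)
  also have "\<dots> = (\<integral>\<^sup>+ i. (\<integral>\<^sup>+ y. ?J i y \<partial>lborel) \<partial>count_space UNIV)"
    by (simp add: shift)
  also have "\<dots> = (\<integral>\<^sup>+ y. (\<integral>\<^sup>+ i. ?J i y \<partial>count_space UNIV) \<partial>lborel)"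
    by (rule nn_integral_count_space_nn_integral[symmetric]) (use mJ in auto)
  also have "\<dots> \<le> (\<integral>\<^sup>+ y. ennreal (G y) \<partial>lborel)"
  proof (rule nn_integral_mono)
    fix y
    let ?A = "{i. y \<in> ball (x0 + \<phi> i) r}"
    have A: "i = j" if "i \<in> ?A" "j \<in> ?A" for i j
    proof (rule ccontr)
      assume "i \<noteq> j"
      have "dist (\<phi> i) (\<phi> j) = dist (x0 + \<phi> i) (x0 + \<phi> j)" by simp
      also have "\<dots> < 2 * r"
        using that dist_triangle[of "x0 + \<phi> i" "x0 + \<phi> j" y] by (simp add: dist_commute)
      finally show False using sep[OF \<open>i \<noteq> j\<close>] by simp
    qed
    have "(\<integral>\<^sup>+ i. indicator ?A i \<partial>count_space UNIV) = emeasure (count_space UNIV) ?A"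
      by (rule nn_integral_indicator) simp
    also have "\<dots> \<le> 1"
    proof (cases "?A = {}")
      case False
      then obtain i where "?A = {i}" using A by blast
      then show ?thesis by (simp add: emeasure_count_space)
    qed (simp add: emeasure_count_space)
    finally have le: "(\<integral>\<^sup>+ i. indicator ?A i \<partial>count_space UNIV) \<le> (1::ennreal)" .
    have "(\<integral>\<^sup>+ i. ?J i y \<partial>count_space UNIV) = (\<integral>\<^sup>+ i. ennreal (G y) * indicator ?A i \<partial>count_space UNIV)"
      by (intro nn_integral_cong) (simp add: indicator_def)
    also have "\<dots> = ennreal (G y) * (\<integral>\<^sup>+ i. indicator ?A i \<partial>count_space UNIV)"
      by (rule nn_integral_cmult) simp
    also have "\<dots> \<le> ennreal (G y) * 1" by (rule mult_left_mono[OF le]) simp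
    finally show "(\<integral>\<^sup>+ i. ?J i y \<partial>count_space UNIV) \<le> ennreal (G y)" by simp
  qed
  also note fin
  finally have lt: "(\<integral>\<^sup>+ x. (\<integral>\<^sup>+ i. ?I i x \<partial>count_space UNIV) \<partial>lborel) < \<infinity>" .
  \<comment> \<open>A sum infinite on the whole ball would have infinite integral, since a ball of
    positive radius is not a null set.\<close>
  have "\<exists>x\<in>ball x0 r. (\<integral>\<^sup>+ i. ?I i x \<partial>count_space UNIV) \<noteq> \<infinity>"
  proof (rule ccontr)
    assume "\<not> ?thesis"
    then have "(\<integral>\<^sup>+ x. \<infinity> * indicator (ball x0 r) x \<partial>lborel)
        \<le> (\<integral>\<^sup>+ x. (\<integral>\<^sup>+ i. ?I i x \<partial>count_space UNIV) \<partial>lborel)"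
      by (intro nn_integral_mono) (auto simp: indicator_def)
    also note lt
    finally have "\<infinity> * emeasure lborel (ball x0 r) < \<infinity>"
      by (subst (asm) nn_integral_cmult_indicator) auto
    then have "emeasure lborel (ball x0 r) = 0"
      by (auto simp: ennreal_top_mult split: if_splits)
    then have "ball x0 r \<in> null_sets lborel" by auto
    then have "negligible (ball x0 r)"
      by (metis negligible_iff_null_sets null_sets_completionI)
    then show False using \<open>0 < r\<close> open_not_negligible[of "ball x0 r"] by auto
  qed
  then obtain x where x: "x \<in> ball x0 r" "(\<integral>\<^sup>+ i. ?I i x \<partial>count_space UNIV) \<noteq> \<infinity>" by blast
  have "(\<integral>\<^sup>+ i. ennreal (G (x + \<phi> i)) \<partial>count_space UNIV) < \<infinity>"
    using x by (simp add: less_top)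
  then have "integrable (count_space UNIV) (\<lambda>i. G (x + \<phi> i))"
    using G(2) by (intro integrableI_nonneg) auto
  then have "(\<lambda>i. G (x + \<phi> i)) summable_on UNIV"
    unfolding Infinite_Set_Sum.abs_summable_on_def[symmetric]
    by (simp add: abs_summable_equivalent[symmetric] abs_summable_summable)
  with x that show ?thesis by blast
qed

text \<open>For \<open>h z = g z * exp (- |z|^2 / 2)\<close> the summand is
  \<open>weyl (- b m) g z * exp (- |z|^2 / 2)\<close>: the phase is what the Weyl operator leaves
  once the Gaussian weight has absorbed its modulus.\<close>

definition twisted_relation :: "nat \<Rightarrow> (nat \<Rightarrow> complex) \<Rightarrow> (complex \<Rightarrow> complex) \<Rightarrow> bool" where
  "twisted_relation d b h \<longleftrightarrow> (\<forall>z. (\<Sum>m<d. cis (Im (cnj (b m) * z)) * h (z - b m)) = 0)"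

text \<open>Translations with the opposite phase commute with those in the relation, because
  \<open>Im (cnj u * b)\<close> is antisymmetric in \<open>u\<close> and \<open>b\<close>.\<close>

lemma twisted_relation_translate:
  assumes "twisted_relation d b h"
  shows "twisted_relation d b (\<lambda>z. cis (- Im (cnj u * z)) * h (z - u))"
  unfolding twisted_relation_def
proof
  fix z
  have "cis (Im (cnj (b m) * z)) * (cis (- Im (cnj u * (z - b m))) * h (z - b m - u))
      = cis (- Im (cnj u * z)) * (cis (Im (cnj (b m) * (z - u))) * h (z - u - b m))" for m
  proof -
    have "Im (cnj (b m) * z) + - Im (cnj u * (z - b m)) = - Im (cnj u * z) + Im (cnj (b m) * (z - u))"
      by (simp add: algebra_simps)
    moreover have "z - u - b m = z - b m - u" by simp
    ultimately show ?thesis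
      by (simp only: mult.assoc[symmetric] cis_mult)
  qed
  then have "(\<Sum>m<d. cis (Im (cnj (b m) * z)) * (cis (- Im (cnj u * (z - b m))) * h (z - b m - u)))
      = cis (- Im (cnj u * z)) * (\<Sum>m<d. cis (Im (cnj (b m) * (z - u))) * h (z - u - b m))"
    by (simp add: sum_distrib_left)
  then show "(\<Sum>m<d. cis (Im (cnj (b m) * z)) * (cis (- Im (cnj u * (z - b m))) * h (z - b m - u))) = 0"
    using assms unfolding twisted_relation_def by (simp only: mult_zero_right)
qed

lemma lattice_summable_imp_zero:
  fixes \<phi> :: "int \<times> int \<Rightarrow> complex" and os :: "nat \<Rightarrow> int \<times> int"
  assumes rel: "twisted_relation d b h"
    and b: "\<And>m. m < d \<Longrightarrow> b m = \<phi> (os m)"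
    and \<phi>: "\<And>x y. \<phi> (x - y) = \<phi> x - \<phi> y"
    and m0: "m0 < d"
    and low: "\<And>m. m < d \<Longrightarrow> m \<noteq> m0 \<Longrightarrow> snd (os m0) < snd (os m)"
    and bd: "\<And>m. m < d \<Longrightarrow> \<bar>fst (os m)\<bar> \<le> 1 \<and> \<bar>snd (os m)\<bar> \<le> 2"
    and summ: "(\<lambda>x. (cmod (h (w + \<phi> x)))\<^sup>2) summable_on UNIV"
  shows "h w = 0"
proof -
  \<comment> \<open>Translating by \<open>- w\<close> carries the coset of \<open>w\<close> to the
    lattice itself; the phase preserves the relation and leaves absolute values unchanged.\<close>
  define k where "k = (\<lambda>z. cis (- Im (cnj (- w) * z)) * h (z - (- w)))"
  define V where "V = {v. \<forall>x. (\<Sum>m<d. cis (Im (cnj (b m) * \<phi> x)) * v (x - os m)) = 0}"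
  define a where "a \<mu> x = cis (- Im (cnj (\<phi> \<mu>) * \<phi> x))" for \<mu> x
  have k: "twisted_relation d b k"
    unfolding k_def by (rule twisted_relation_translate[OF rel])
  have \<phi>0: "\<phi> 0 = 0" using \<phi>[of 0 0] by simp
  have "k (\<phi> 0) = 0"
  proof (rule twisted_translates_zero[where V = V and a = a])
    show "(\<lambda>x. (cmod (k (\<phi> x)))\<^sup>2) summable_on UNIV"
      using summ by (simp add: k_def norm_mult add.commute)
    show "(\<lambda>x. u x + c * v x) \<in> V" if "u \<in> V" "v \<in> V" for u v c
    proof -
      have "(\<Sum>m<d. cis (Im (cnj (b m) * \<phi> x)) * (u (x - os m) + c * v (x - os m)))
        = (\<Sum>m<d. cis (Im (cnj (b m) * \<phi> x)) * u (x - os m))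
          + c * (\<Sum>m<d. cis (Im (cnj (b m) * \<phi> x)) * v (x - os m))" for x
        unfolding sum_distrib_left sum.distrib[symmetric]
        by (intro sum.cong refl) (simp only: ring_distribs mult.left_commute)
      then show ?thesis using that by (simp add: V_def)
    qed
    show "cmod (a \<mu> x) = 1" for \<mu> x by (simp add: a_def)
    show "(\<lambda>x. a \<mu> x * k (\<phi> (x - \<mu>))) \<in> V" for \<mu>
      unfolding V_def
    proof (intro CollectI allI)
      fix x
      have "(\<Sum>m<d. cis (Im (cnj (b m) * \<phi> x)) * (a \<mu> (x - os m) * k (\<phi> (x - os m - \<mu>))))
        = (\<Sum>m<d. cis (Im (cnj (b m) * \<phi> x)) * (cis (- Im (cnj (\<phi> \<mu>) * (\<phi> x - b m))) * k (\<phi> x - b m - \<phi> \<mu>)))"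
        by (intro sum.cong refl) (simp add: a_def \<phi> b)
      also have "\<dots> = 0"
        using twisted_relation_translate[OF k, of "\<phi> \<mu>"] by (simp only: twisted_relation_def)
      finally show "(\<Sum>m<d. cis (Im (cnj (b m) * \<phi> x)) * (a \<mu> (x - os m) * k (\<phi> (x - os m - \<mu>)))) = 0" .
    qed
    show "\<exists>S D. finite S \<and> finite D \<and> S \<noteq> {} \<and> n * card D \<le> card S \<and>
        (\<forall>v\<in>V. (\<forall>x\<in>D. v x = 0) \<longrightarrow> (\<forall>x\<in>S. v x = 0))" for n
      unfolding V_def by (rule bands_determine_boxes[of m0]) (use m0 low bd in auto)
  qed
  then show ?thesis by (simp add: k_def \<phi>0)
qed

lemma cmod_lattice_ge:
  fixes \<tau> :: complex and p q :: int
  assumes "1 / 2 \<le> \<bar>Im \<tau>\<bar>" "(p, q) \<noteq> 0"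
  shows "1 / 2 \<le> cmod (of_int p * \<tau> + of_int q)"
proof (cases "p = 0")
  case True
  then have "1 \<le> \<bar>q\<bar>" using assms by (auto simp: zero_prod_def)
  then have "1 \<le> \<bar>real_of_int q\<bar>" by linarith
  then show ?thesis using True by simp
next
  case False
  then have "1 \<le> \<bar>p\<bar>" by simp
  then have "1 \<le> \<bar>real_of_int p\<bar>" by linarith
  then have "1 * (1 / 2) \<le> \<bar>real_of_int p\<bar> * \<bar>Im \<tau>\<bar>" using assms by (intro mult_mono) auto
  also have "\<dots> = \<bar>Im (of_int p * \<tau> + of_int q)\<bar>" by (simp add: abs_mult)
  also have "\<dots> \<le> cmod (of_int p * \<tau> + of_int q)" by (rule abs_Im_le_cmod)
  finally show ?thesis by simp
qed

text \<open>Summability holds only on some cosets, but one of them meets any small ball around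
  \<open>z\<close>. Continuity would make \<open>h\<close> nonzero on such a ball, while
  \<open>h\<close> vanishes at the point found.\<close>

lemma square_integrable_twisted_imp_zero:
  fixes \<beta> \<tau> :: complex and os :: "nat \<Rightarrow> int \<times> int"
  assumes "\<beta> \<noteq> 0" and \<tau>: "1 / 2 \<le> \<bar>Im \<tau>\<bar>"
    and rel: "twisted_relation d b h"
    and b: "\<And>m. m < d \<Longrightarrow> b m = \<beta> * (of_int (fst (os m)) * \<tau> + of_int (snd (os m)))"
    and m0: "m0 < d"
    and low: "\<And>m. m < d \<Longrightarrow> m \<noteq> m0 \<Longrightarrow> snd (os m0) < snd (os m)"
    and bd: "\<And>m. m < d \<Longrightarrow> \<bar>fst (os m)\<bar> \<le> 1 \<and> \<bar>snd (os m)\<bar> \<le> 2"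
    and cont: "continuous_on UNIV h"
    and fin: "(\<integral>\<^sup>+ z. ennreal ((cmod (h z))\<^sup>2) \<partial>lborel) < \<infinity>"
  shows "h z = 0"
proof (rule ccontr)
  assume "h z \<noteq> 0"
  define \<phi> where "\<phi> x = \<beta> * (of_int (fst x) * \<tau> + of_int (snd x))" for x :: "int \<times> int"
  have \<phi>: "\<phi> (x - y) = \<phi> x - \<phi> y" for x y by (simp add: \<phi>_def algebra_simps)
  have "isCont h z" using cont by (simp add: continuous_on_eq_continuous_at)
  then obtain e where e: "e > 0" "\<And>y. dist z y < e \<Longrightarrow> h y \<noteq> 0"
    using continuous_at_avoid[of z h 0] \<open>h z \<noteq> 0\<close> by blast
  \<comment> \<open>Distinct lattice points are at least \<open>cmod \<beta> / 2\<close> apart,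
    which is twice the second bound; the first keeps the ball where \<open>h\<close> is
    nonzero.\<close>
  define r where "r = min e (cmod \<beta> / 4)"
  have r: "0 < r" using e \<open>\<beta> \<noteq> 0\<close> by (simp add: r_def)
  obtain x where x: "x \<in> ball z r" "(\<lambda>i. (cmod (h (x + \<phi> i)))\<^sup>2) summable_on UNIV"
  proof (rule exists_summable_translate[where G = "\<lambda>z. (cmod (h z))\<^sup>2"])
    show "(\<lambda>z. (cmod (h z))\<^sup>2) \<in> borel_measurable borel"
      by (intro borel_measurable_continuous_onI continuous_intros cont)
    show "2 * r \<le> dist (\<phi> i) (\<phi> j)" if "i \<noteq> j" for i j
    proof -
      have "cmod \<beta> * (1 / 2) \<le> cmod \<beta> * cmod (of_int (fst (i - j)) * \<tau> + of_int (snd (i - j)))"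
        using that by (intro mult_left_mono cmod_lattice_ge \<tau>) (auto simp: prod_eq_iff)
      also have "\<dots> = dist (\<phi> i) (\<phi> j)"
        unfolding dist_norm \<phi>[symmetric] by (simp only: \<phi>_def norm_mult)
      finally show ?thesis by (simp add: r_def)
    qed
  qed (use fin r in auto)
  have "h x = 0"
    by (rule lattice_summable_imp_zero[where \<phi> = \<phi> and os = os, OF rel _ \<phi> m0 low bd x(2)])
      (simp_all add: b \<phi>_def)
  then show False using e(2)[of x] x(1) by (simp add: r_def)
qed

text \<open>
  Lattice bases in which exactly one of the points \<open>\<eta>\<^sup>m\<close> has minimal second coordinate. For \<open>d = 6\<close> the
  basis \<open>1, \<eta>\<close> itself does not have this property, and \<open>1, \<eta> - 2\<close> does.
\<close>

lemma crystallographic_offsets: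
  assumes "d \<in> {2, 3, 4, 6 :: nat}"
  obtains \<tau> :: complex and os :: "nat \<Rightarrow> int \<times> int" and m0
  where "1 / 2 \<le> \<bar>Im \<tau>\<bar>" "m0 < d"
    "\<And>m. m < d \<Longrightarrow> m \<noteq> m0 \<Longrightarrow> snd (os m0) < snd (os m)"
    "\<And>m. m < d \<Longrightarrow> \<bar>fst (os m)\<bar> \<le> 1 \<and> \<bar>snd (os m)\<bar> \<le> 2"
    "\<And>m. m < d \<Longrightarrow> cis (- (2 * pi / d)) ^ m = of_int (fst (os m)) * \<tau> + of_int (snd (os m))"
proof -
  have s3: "1 \<le> sqrt 3" by simp
  consider "d = 2" | "d = 3" | "d = 4" | "d = 6" using assms by auto
  then show thesis
  proof cases
    case 1
    have \<eta>: "cis (- (2 * pi / d)) = - 1" using 1 by (simp add: complex_eq_iff)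
    have m: "m < d \<longleftrightarrow> m = 0 \<or> m = 1" for m using 1 by auto
    \<comment> \<open>Both points \<open>1\<close> and \<open>-1\<close> lie on the second axis;
      \<open>\<i>\<close> completes the basis.\<close>
    show thesis
      by (rule that[of \<i> 1 "\<lambda>m. [(0, 1), (0, -1)] ! m"], unfold \<eta> m) auto
  next
    case 2
    define \<eta> where "\<eta> = cis (- (2 * pi / d))"
    have "\<eta> = cnj (cis (2 * pi / 3))" using 2 by (simp add: \<eta>_def cis_cnj)
    also have "\<dots> = Complex (- 1 / 2) (- sqrt 3 / 2)"
      by (simp add: complex_eq_iff cos_120 sin_120)
    finally have \<eta>: "\<eta> = Complex (- 1 / 2) (- sqrt 3 / 2)" .
    then have \<eta>2: "\<eta>\<^sup>2 = - 1 - \<eta>" by (simp add: complex_eq_iff power2_eq_square)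
    have m: "m < d \<longleftrightarrow> m = 0 \<or> m = 1 \<or> m = 2" for m using 2 by auto
    \<comment> \<open>In the basis \<open>\<eta> - 1\<close>, \<open>1\<close> the lowest second
      coordinate is -2, attained only by \<open>\<eta>^2\<close>.\<close>
    show thesis
      by (rule that[of "\<eta> - 1" 2 "\<lambda>m. [(0, 1), (1, 1), (-1, -2)] ! m"], unfold \<eta>_def[symmetric] m)
        (use s3 in \<open>auto simp: \<eta>2 \<eta> complex_eq_iff power2_eq_square\<close>)
  next
    case 3
    have \<eta>: "cis (- (2 * pi / d)) = - \<i>" using 3 by (simp add: complex_eq_iff)
    have m: "m < d \<longleftrightarrow> m = 0 \<or> m = 1 \<or> m = 2 \<or> m = 3" for m using 3 by auto
    show thesis
      by (rule that[of "- \<i>" 2 "\<lambda>m. [(0, 1), (1, 0), (0, -1), (-1, 0)] ! m"], unfold \<eta> m)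
        (auto simp: power3_eq_cube)
  next
    case 4
    define \<eta> where "\<eta> = cis (- (2 * pi / d))"
    have "\<eta> = cnj (cis (pi / 3))" using 4 by (simp add: \<eta>_def cis_cnj)
    also have "\<dots> = Complex (1 / 2) (- sqrt 3 / 2)"
      by (simp add: complex_eq_iff cos_60 sin_60)
    finally have \<eta>: "\<eta> = Complex (1 / 2) (- sqrt 3 / 2)" .
    have \<eta>2: "\<eta> * \<eta> = \<eta> - 1" unfolding \<eta> by (simp add: complex_eq_iff)
    have \<eta>3: "\<eta> ^ 3 = - 1" by (simp add: power3_eq_cube \<eta>2 algebra_simps)
    have \<eta>4: "\<eta> ^ 4 = - \<eta>" using \<eta>3 power_Suc[of \<eta> 3] by simp
    have \<eta>5: "\<eta> ^ 5 = 1 - \<eta>" using \<eta>4 \<eta>2 power_Suc[of \<eta> 4] by simp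
    have m: "m < d \<longleftrightarrow> m = 0 \<or> m = 1 \<or> m = 2 \<or> m = 3 \<or> m = 4 \<or> m = 5" for m
      using 4 by presburger
    show thesis
      by (rule that[of "\<eta> - 2" 4 "\<lambda>m. [(0, 1), (1, 2), (1, 1), (0, -1), (-1, -2), (-1, -1)] ! m"],
          unfold \<eta>_def[symmetric] m)
        (use s3 in \<open>auto simp: \<eta>2 \<eta>3 \<eta>4 \<eta>5 power2_eq_square\<close>, auto simp: \<eta>)
  qed
qed

section \<open>Taylor coefficients, rotations and the Weyl operator\<close>

lemma entire_power_series:
  assumes "f holomorphic_on UNIV"
  shows "(\<lambda>n. (deriv ^^ n) f 0 / fact n * w ^ n) sums f w"
  using holomorphic_power_series[of f 0 "cmod w + 1" w] assms
  by (auto intro: holomorphic_on_subset)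

lemma sum_powers_root_of_unity:
  assumes "0 < d" "\<not> d dvd n"
  shows "(\<Sum>m<d. cis (2 * pi / d) ^ (m * n)) = 0"
proof -
  define x where "x = cis (2 * pi / d) ^ n"
  have x: "x = exp (2 * of_real pi * \<i> * of_nat n / of_nat d)"
    by (simp add: x_def cis_conv_exp exp_of_nat_mult[symmetric] mult_ac)
  have "x \<noteq> 1" unfolding x using complex_root_unity_eq_1[of d n] assms by simp
  moreover have "x ^ d = 1" unfolding x using complex_root_unity[of d n] assms by simp
  ultimately have "(\<Sum>m<d. x ^ m) = 0" by (simp add: geometric_sum)
  then show ?thesis by (simp add: x_def power_mult[symmetric] mult.commute)
qed

text \<open>Summing over the rotations annihilates every power \<open>z ^ n\<close> with
  \<open>d\<close> not dividing \<open>n\<close>, and the remaining coefficients vanish by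
  assumption.\<close>

lemma sum_rotations_eq_0:
  assumes "f holomorphic_on UNIV" "0 < d"
    and "\<And>n. d dvd n \<Longrightarrow> (deriv ^^ n) f 0 = 0"
  shows "(\<Sum>m<d. f (cis (2 * pi / d) ^ m * z)) = 0"
proof -
  let ?c = "\<lambda>n. (deriv ^^ n) f 0 / fact n"
  have "(\<lambda>n. \<Sum>m<d. ?c n * (cis (2 * pi / d) ^ m * z) ^ n) sums (\<Sum>m<d. f (cis (2 * pi / d) ^ m * z))"
    by (intro sums_sum entire_power_series assms)
  moreover have "(\<Sum>m<d. ?c n * (cis (2 * pi / d) ^ m * z) ^ n) = 0" for n
  proof (cases "d dvd n")
    case False
    have "(\<Sum>m<d. ?c n * (cis (2 * pi / d) ^ m * z) ^ n) = ?c n * z ^ n * (\<Sum>m<d. cis (2 * pi / d) ^ (m * n))"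
      unfolding sum_distrib_left
      by (intro sum.cong refl) (simp only: power_mult_distrib power_mult mult_ac)
    then show ?thesis using sum_powers_root_of_unity[OF \<open>0 < d\<close> False] by simp
  qed (simp add: assms)
  ultimately have "(\<lambda>n. 0) sums (\<Sum>m<d. f (cis (2 * pi / d) ^ m * z))" by simp
  then show ?thesis using sums_zero by (rule sums_unique2)
qed

text \<open>Only powers of \<open>z ^ d\<close> survive in the Taylor series, and these do not see a
  rotation by a \<open>d\<close>-th root of unity.\<close>

lemma rotation_invariant:
  assumes "g holomorphic_on UNIV" "0 < d"
    and "\<And>n. \<not> d dvd n \<Longrightarrow> (deriv ^^ n) g 0 = 0"
  shows "g (cis (2 * pi / d) ^ m * z) = g z"
proof -
  have "(deriv ^^ n) g 0 / fact n * (cis (2 * pi / d) ^ m * z) ^ n = (deriv ^^ n) g 0 / fact n * z ^ n" for n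
  proof (cases "d dvd n")
    case True
    then obtain k where n: "n = d * k" by blast
    have "cis (2 * pi / d) ^ d = 1" using \<open>0 < d\<close> by (simp add: Complex.DeMoivre)
    then have "(cis (2 * pi / d) ^ m) ^ n = 1"
      unfolding n by (metis power_mult power_one mult.commute)
    then show ?thesis by (simp add: power_mult_distrib)
  qed (simp add: assms)
  then have "(\<lambda>n. (deriv ^^ n) g 0 / fact n * z ^ n) sums g (cis (2 * pi / d) ^ m * z)"
    using entire_power_series[OF assms(1), of "cis (2 * pi / d) ^ m * z"] by (simp only:)
  then show ?thesis using entire_power_series[OF assms(1)] by (rule sums_unique2)
qed

text \<open>Rotation invariance replaces \<open>z - b m\<close> by
  \<open>\<omega> ^ m * z - \<beta>\<close> in \<open>weyl \<beta> f\<close>, which exposes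
  \<open>f (\<omega> ^ m * z)\<close>. The relation thus becomes the vanishing orbit sum of
  \<open>f\<close>.\<close>

lemma twisted_relation_gaussian:
  assumes "f holomorphic_on UNIV" and d: "0 < d"
    and f: "\<And>n. d dvd n \<Longrightarrow> (deriv ^^ n) f 0 = 0"
    and g: "\<And>n. \<not> d dvd n \<Longrightarrow> (deriv ^^ n) (weyl \<beta> f) 0 = 0"
    and hol: "weyl \<beta> f holomorphic_on UNIV"
  shows "twisted_relation d (\<lambda>m. \<beta> * cis (- (2 * pi / d)) ^ m)
    (\<lambda>z. weyl \<beta> f z * exp (- complex_of_real ((cmod z)\<^sup>2) / 2))"
  unfolding twisted_relation_def
proof
  fix z
  define \<omega> where "\<omega> = cis (2 * pi / d)"
  define b where "b m = \<beta> * cis (- (2 * pi / d)) ^ m" for m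
  have cb: "cnj (b m) = cnj \<beta> * \<omega> ^ m" for m
    by (simp add: b_def \<omega>_def cis_cnj)
  have \<omega>b: "\<omega> ^ m * b m = \<beta>" for m
    by (simp add: b_def \<omega>_def power_mult_distrib[symmetric] cis_mult mult.left_commute)
  have nb: "cmod (b m) = cmod \<beta>" for m by (simp add: b_def norm_mult norm_power)
  have "cis (Im (cnj (b m) * z)) * (weyl \<beta> f (z - b m) * exp (- complex_of_real ((cmod (z - b m))\<^sup>2) / 2))
     = exp (- complex_of_real ((cmod z)\<^sup>2) / 2) * f (\<omega> ^ m * z)" for m
  proof -
    have "weyl \<beta> f (z - b m) = weyl \<beta> f (\<omega> ^ m * (z - b m))"
      unfolding \<omega>_def using rotation_invariant[OF hol d g] by simp
    also have "\<omega> ^ m * (z - b m) = \<omega> ^ m * z - \<beta>" by (simp add: right_diff_distrib \<omega>b)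
    also have "weyl \<beta> f \<dots> = exp (complex_of_real ((cmod \<beta>)\<^sup>2) / 2 - cnj (b m) * z) * f (\<omega> ^ m * z)"
    proof -
      have "cnj \<beta> * \<beta> = complex_of_real ((cmod \<beta>)\<^sup>2)"
        by (metis complex_norm_square mult.commute of_real_power)
      then have "- complex_of_real ((cmod \<beta>)\<^sup>2) / 2 - cnj \<beta> * (\<omega> ^ m * z - \<beta>)
          = complex_of_real ((cmod \<beta>)\<^sup>2) / 2 - cnj (b m) * z"
        by (simp add: cb algebra_simps)
      then show ?thesis unfolding weyl_def by (simp only: diff_add_cancel)
    qed
    finally have w: "weyl \<beta> f (z - b m) = \<dots>" .
    have "(cmod (z - b m))\<^sup>2 = (cmod z)\<^sup>2 + (cmod \<beta>)\<^sup>2 - 2 * Re (cnj (b m) * z)"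
      unfolding nb[of m, symmetric] by (simp add: cmod_power2) (simp add: power2_eq_square algebra_simps)
    \<comment> \<open>The phase cancels the imaginary part of \<open>cnj (b m) * z\<close> and the
      Gaussian its real part, so the weight left over is the same for all \<open>m\<close> and
      factors out of the sum.\<close>
    then have e: "\<i> * of_real (Im (cnj (b m) * z)) + (complex_of_real ((cmod \<beta>)\<^sup>2) / 2 - cnj (b m) * z)
        + - complex_of_real ((cmod (z - b m))\<^sup>2) / 2 = - complex_of_real ((cmod z)\<^sup>2) / 2"
      by (simp add: complex_eq_iff field_simps)
    show ?thesis
      unfolding w cis_conv_exp e[symmetric] exp_add by (simp only: mult_ac)
  qed
  then have "(\<Sum>m<d. cis (Im (cnj (b m) * z)) * (weyl \<beta> f (z - b m) * exp (- complex_of_real ((cmod (z - b m))\<^sup>2) / 2)))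
     = exp (- complex_of_real ((cmod z)\<^sup>2) / 2) * (\<Sum>m<d. f (\<omega> ^ m * z))"
    by (simp add: sum_distrib_left)
  also have "\<dots> = 0" unfolding \<omega>_def using sum_rotations_eq_0[OF assms(1) d f] by simp
  finally show "(\<Sum>m<d. cis (Im (cnj (\<beta> * cis (- (2 * pi / d)) ^ m) * z)) *
      (weyl \<beta> f (z - \<beta> * cis (- (2 * pi / d)) ^ m)
        * exp (- complex_of_real ((cmod (z - \<beta> * cis (- (2 * pi / d)) ^ m))\<^sup>2) / 2))) = 0"
    unfolding b_def .
qed

text \<open>Pointwise form of the unitarity of the Weyl operator: completing the square shifts the
  weighted density of \<open>f\<close> by \<open>\<beta>\<close>.\<close>

lemma weyl_gaussian_cmod:
  "(cmod (weyl \<beta> f z * exp (- complex_of_real ((cmod z)\<^sup>2) / 2)))\<^sup>2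
    = (cmod (f (z + \<beta>)))\<^sup>2 * exp (- (cmod (z + \<beta>))\<^sup>2)"
proof -
  have n: "(cmod (z + \<beta>))\<^sup>2 = (cmod z)\<^sup>2 + (cmod \<beta>)\<^sup>2 + 2 * Re (cnj \<beta> * z)"
    by (simp add: cmod_power2) (simp add: power2_eq_square algebra_simps)
  have e: "2 * Re (- complex_of_real ((cmod \<beta>)\<^sup>2) / 2 - cnj \<beta> * z)
      + 2 * Re (- complex_of_real ((cmod z)\<^sup>2) / 2) = - (cmod (z + \<beta>))\<^sup>2"
    unfolding n by simp
  show ?thesis
    unfolding e[symmetric] exp_add exp_double weyl_def norm_mult norm_exp_eq_Re power_mult_distrib
    by (simp only: mult_ac)
qed

lemma fock_space_nn_integral_lborel:
  assumes "f \<in> fock_space"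
  shows "(\<integral>\<^sup>+ z. ennreal ((cmod (f z))\<^sup>2 * exp (- (cmod z)\<^sup>2)) \<partial>lborel) < \<infinity>"
proof -
  have "continuous_on UNIV f"
    using assms by (auto simp: fock_space_def intro: holomorphic_on_imp_continuous_on)
  then have m: "(\<lambda>z. (cmod (f z))\<^sup>2 * exp (- (cmod z)\<^sup>2)) \<in> borel_measurable borel"
    by (intro borel_measurable_continuous_onI continuous_intros)
  have "ennreal (1 / pi) * (\<integral>\<^sup>+ z. ennreal ((cmod (f z))\<^sup>2 * exp (- (cmod z)\<^sup>2)) \<partial>lborel) < \<infinity>"
    using assms m unfolding fock_space_def area_measure_def
    by (simp add: nn_integral_density nn_integral_cmult)
  then show ?thesis by (auto simp: ennreal_mult_less_top)
qed

theorem corollary8: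
  fixes d :: nat and \<beta> :: complex and \<beta>s :: "nat \<Rightarrow> complex" and f :: "complex \<Rightarrow> complex"
  assumes "d \<in> {2, 3, 4, 6}"
    and "\<beta>s 0 = 0"
    and "\<And>k. k \<in> {1..d - 1} \<Longrightarrow> \<beta>s k = \<beta>"
    and "f \<in> fock_space"
    and "\<And>k j. k < d \<Longrightarrow> j \<in> progression d k \<Longrightarrow> (deriv ^^ j) (weyl (\<beta>s k) f) 0 = 0"
  shows "f = (\<lambda>z. 0)"
proof -
  have d: "0 < d" using assms(1) by auto
  have hol: "f holomorphic_on UNIV" using assms(4) by (simp add: fock_space_def)
  have w0: "weyl 0 f = f" by (simp add: weyl_def)
  have "f holomorphic_on (\<lambda>z. z + \<beta>) ` UNIV" using hol by (rule holomorphic_on_subset) simp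
  then have "(f \<circ> (\<lambda>z. z + \<beta>)) holomorphic_on UNIV"
    by (intro holomorphic_on_compose holomorphic_intros)
  then have holg: "weyl \<beta> f holomorphic_on UNIV"
    unfolding weyl_def o_def by (intro holomorphic_intros)
  \<comment> \<open>Each \<open>n\<close> lies in the progression of its residue, so residue 0
    constrains \<open>f\<close> and the others constrain \<open>weyl \<beta> f\<close>.\<close>
  have der: "(deriv ^^ n) (weyl (\<beta>s (n mod d)) f) 0 = 0" for n
  proof (rule assms(5))
    show "n \<in> progression d (n mod d)"
      unfolding progression_def by (intro CollectI exI[of _ "n div d"]) simp
  qed (use d in simp)
  have f0: "(deriv ^^ n) f 0 = 0" if "d dvd n" for n
    using der[of n] that assms(2) w0 by simp
  have g0: "(deriv ^^ n) (weyl \<beta> f) 0 = 0" if "\<not> d dvd n" for n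
  proof -
    have "n mod d \<in> {1..d - 1}"
      using that d mod_less_divisor[OF d, of n] by (auto simp: dvd_eq_mod_eq_0 Suc_le_eq)
    then show ?thesis using der[of n] assms(3) by simp
  qed
  show ?thesis
  proof (cases "\<beta> = 0")
    \<comment> \<open>Here the lattice degenerates, but both families of conditions concern
      \<open>f\<close> itself and together cover all Taylor coefficients.\<close>
    case True
    then have "(deriv ^^ n) f 0 = 0" for n using f0 g0 w0 by metis
    then have "f z = 0" for z
      using entire_power_series[OF hol, of z] by (simp add: sums_iff)
    then show ?thesis by blast
  next
    case False
    define h where "h = (\<lambda>z. weyl \<beta> f z * exp (- complex_of_real ((cmod z)\<^sup>2) / 2))"
    obtain \<tau> os m0 where os: "1 / 2 \<le> \<bar>Im \<tau>\<bar>" "m0 < d"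
      "\<And>m. m < d \<Longrightarrow> m \<noteq> m0 \<Longrightarrow> snd (os m0) < snd (os m)"
      "\<And>m. m < d \<Longrightarrow> \<bar>fst (os m)\<bar> \<le> 1 \<and> \<bar>snd (os m)\<bar> \<le> 2"
      "\<And>m. m < d \<Longrightarrow> cis (- (2 * pi / d)) ^ m = of_int (fst (os m)) * \<tau> + of_int (snd (os m))"
      by (rule crystallographic_offsets[OF assms(1)]) (rule that; assumption)
    have "continuous_on UNIV (weyl \<beta> f)" using holg by (rule holomorphic_on_imp_continuous_on)
    then have cont: "continuous_on UNIV h" unfolding h_def by (intro continuous_intros) auto
    define F where "F z = ennreal ((cmod (f z))\<^sup>2 * exp (- (cmod z)\<^sup>2))" for z
    have "continuous_on UNIV f" using hol by (rule holomorphic_on_imp_continuous_on)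
    then have "(\<lambda>z. (cmod (f z))\<^sup>2 * exp (- (cmod z)\<^sup>2)) \<in> borel_measurable borel"
      by (intro borel_measurable_continuous_onI continuous_intros)
    then have F: "F \<in> borel_measurable borel"
      unfolding F_def by (rule measurable_compose[OF _ measurable_ennreal])
    have "(\<integral>\<^sup>+ z. ennreal ((cmod (h z))\<^sup>2) \<partial>lborel) = (\<integral>\<^sup>+ z. F (\<beta> + z) \<partial>lborel)"
      by (simp only: h_def weyl_gaussian_cmod F_def add.commute)
    also have "\<dots> = (\<integral>\<^sup>+ z. F z \<partial>distr lborel borel ((+) \<beta>))"
      using F by (intro nn_integral_distr[symmetric]) auto
    also have "\<dots> < \<infinity>"
      unfolding lborel_distr_plus F_def by (rule fock_space_nn_integral_lborel[OF assms(4)])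
    finally have fin: "(\<integral>\<^sup>+ z. ennreal ((cmod (h z))\<^sup>2) \<partial>lborel) < \<infinity>" .
    have rel: "twisted_relation d (\<lambda>m. \<beta> * cis (- (2 * pi / d)) ^ m) h"
      unfolding h_def by (rule twisted_relation_gaussian[OF hol d f0 g0 holg])
    have "h z = 0" for z
      by (rule square_integrable_twisted_imp_zero[where os = os, OF False os(1) rel _ os(2-4) cont fin])
        (simp_all add: os(5))
    then have "weyl \<beta> f z = 0" for z by (simp add: h_def)
    \<comment> \<open>The exponential factor never vanishes, and evaluating at
      \<open>z - \<beta>\<close> reaches every argument of \<open>f\<close>.\<close>
    then have "f (z - \<beta> + \<beta>) = 0" for z
      by (simp only: weyl_def mult_eq_0_iff exp_not_eq_zero simp_thms)
    then show ?thesis by (simp add: fun_eq_iff)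
  qed
qed

end
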